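(* Let $k\ge 1$ be a real number and let $\alpha,\beta,\gamma,\lambda\in\mathbb{H}$ be quaternions with $|\alpha|,|\beta|,|\gamma|,|\lambda|\le k$. Assume that $$\alpha+\beta+\gamma+\lambda=0,\qquad \alpha\beta+\alpha\gamma+\alpha\lambda+\beta\gamma+\beta\lambda+\gamma\lambda=0,$$ and let $$P(q)=(q-\alpha)*(q-\beta)*(q-\gamma)*(q-\lambda).$$ Then the following hold. (i) Suppose $1\le k<3^{1/4}$, and define $$x^{*}=(A+B)^{1/3}+(A-B)^{1/3}$$ (real cube roots), where $$A=-\frac{(3-k^{4})k^{3}-4k^{4}}{2(3-k^{4})},\qquad B=\sqrt{\frac{\bigl((3-k^{4})k^{3}-4k^{4}\bigr)^{2}}{4(3-k^{4})^{2}}+\frac{(4k^{3})^{3}}{27(3-k^{4})^{3}}}.$$ If at least one of the following four conditions holds: $|\alpha|\le x^{*}$; $\beta\in\mathbb{R}$ and $|\beta|\le x^{*}$; $\gamma\in\mathbb{R}$ and $|\gamma|\le x^{*}$; $|\lambda|\le x^{*}$; then $$\|P'\|\ \ge\ \frac{4}{1+k^{4}}\,\|P\|.$$ (ii) If $k\ge 3^{1/4}$, then $$\|P'\|\ \ge\ \frac{4}{1+k^{4}}\,\|P\|$$ with no further assumption on $\alpha,\beta,\gamma,\lambda$.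
   Context: $\mathbb{H}$ denotes the quaternions with the usual norm $|\cdot|$, and $\mathbb{R}\subset\mathbb{H}$ the real quaternions. Polynomials are unilateral quaternionic polynomials with coefficients on the right, $P(q)=\sum_{m=0}^{n}q^{m}a_m$ with $a_m\in\mathbb{H}$, regarded as functions of $q\in\mathbb{H}$. The product $*$ is the (associative) convolution product: for $P_1(q)=\sum_i q^{i}a_i$ and $P_2(q)=\sum_j q^{j}b_j$, $(P_1*P_2)(q)=\sum_{i,j}q^{i+j}a_ib_j$. The derivative of $P(q)=\sum_{m=0}^{n}q^{m}a_m$ is $P'(q)=\sum_{m=1}^{n}m\,q^{m-1}a_m$. The norm of a polynomial is $\|P\|=\max\{|P(q)|: q\in\mathbb{H},\ |q|\le 1\}=\max\{|P(q)|: q\in\mathbb{H},\ |q|=1\}$. *)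

theory Defs
  imports "HOL-Analysis.Analysis" "HOL-Computational_Algebra.Polynomial"
begin

section \<open>The quaternions\<close>

text \<open>\<open>Quat a b c d\<close> stands for $a + b i + c j + d k$.\<close>

datatype quat = Quat (qre: real) (qim1: real) (qim2: real) (qim3: real)

lemma quat_eq_iff:
  "x = y \<longleftrightarrow> qre x = qre y \<and> qim1 x = qim1 y \<and> qim2 x = qim2 y \<and> qim3 x = qim3 y"
  by (cases x; cases y) simp

instantiation quat :: ab_group_add
begin

definition "0 = Quat 0 0 0 0"

definition "x + y = Quat (qre x + qre y) (qim1 x + qim1 y) (qim2 x + qim2 y) (qim3 x + qim3 y)"

definition "- x = Quat (- qre x) (- qim1 x) (- qim2 x) (- qim3 x)"

definition "x - y = Quat (qre x - qre y) (qim1 x - qim1 y) (qim2 x - qim2 y) (qim3 x - qim3 y)"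

instance
  by standard (simp_all add: zero_quat_def plus_quat_def uminus_quat_def minus_quat_def quat_eq_iff)

end

instantiation quat :: ring_1
begin

definition "1 = Quat 1 0 0 0"

text \<open>The bilinear extension of $i^2 = j^2 = k^2 = ijk = -1$.\<close>

definition
  "x * y = Quat
     (qre x * qre y - qim1 x * qim1 y - qim2 x * qim2 y - qim3 x * qim3 y)
     (qre x * qim1 y + qim1 x * qre y + qim2 x * qim3 y - qim3 x * qim2 y)
     (qre x * qim2 y - qim1 x * qim3 y + qim2 x * qre y + qim3 x * qim1 y)
     (qre x * qim3 y + qim1 x * qim2 y - qim2 x * qim1 y + qim3 x * qre y)"

instance
  by standard
    (simp_all add: zero_quat_def one_quat_def plus_quat_def times_quat_def quat_eq_iff
      algebra_simps)

end

instantiation quat :: real_vector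
begin

definition "r *\<^sub>R x = Quat (r * qre x) (r * qim1 x) (r * qim2 x) (r * qim3 x)"

instance
  by standard (simp_all add: scaleR_quat_def plus_quat_def quat_eq_iff algebra_simps)

end

instantiation quat :: real_inner
begin

definition "x \<bullet> y = qre x * qre y + qim1 x * qim1 y + qim2 x * qim2 y + qim3 x * qim3 y"

definition "norm x = sqrt ((qre x)\<^sup>2 + (qim1 x)\<^sup>2 + (qim2 x)\<^sup>2 + (qim3 x)\<^sup>2)" for x :: quat

definition "sgn x = x /\<^sub>R norm x" for x :: quat

definition "dist x y = norm (x - y)" for x y :: quat

definition
  "(uniformity :: (quat \<times> quat) filter) = (INF e\<in>{0 <..}. principal {(x, y). dist x y < e})"

definition
  "open (U :: quat set) \<longleftrightarrow> (\<forall>x\<in>U. eventually (\<lambda>(x', y). x' = x \<longrightarrow> y \<in> U) uniformity)"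

instance
proof
  fix x y z :: quat and r :: real and U :: "quat set"
  show "x \<bullet> y = y \<bullet> x" "(x + y) \<bullet> z = x \<bullet> z + y \<bullet> z" "r *\<^sub>R x \<bullet> y = r * (x \<bullet> y)"
    by (simp_all add: scaleR_quat_def plus_quat_def inner_quat_def algebra_simps)
  show "0 \<le> x \<bullet> x"
    by (simp add: inner_quat_def)
  show "x \<bullet> x = 0 \<longleftrightarrow> x = 0"
    by (simp add: inner_quat_def zero_quat_def quat_eq_iff add_nonneg_eq_0_iff)
  show "norm x = sqrt (x \<bullet> x)"
    by (simp add: norm_quat_def inner_quat_def power2_eq_square)
qed (rule sgn_quat_def dist_quat_def uniformity_quat_def open_quat_def)+

end

instantiation quat :: real_normed_div_algebra
begin

definition
  "inverse x = Quat (qre x) (- qim1 x) (- qim2 x) (- qim3 x) /\<^sub>R (norm x)\<^sup>2" for x :: quat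

definition "x div y = x * inverse y" for x y :: quat

instance
proof
  fix x y :: quat
  let ?c = "Quat (qre x) (- qim1 x) (- qim2 x) (- qim3 x)"
  show scaleR: "r *\<^sub>R x * y = r *\<^sub>R (x * y)" "x * r *\<^sub>R y = r *\<^sub>R (x * y)"
    for r and x y :: quat
    by (simp_all add: scaleR_quat_def times_quat_def quat_eq_iff algebra_simps)
  have "?c * x = (norm x)\<^sup>2 *\<^sub>R 1" "x * ?c = (norm x)\<^sup>2 *\<^sub>R 1"
    by (simp_all add: norm_quat_def times_quat_def scaleR_quat_def one_quat_def power2_eq_square)
  then show "inverse x * x = 1" "x * inverse x = 1" if "x \<noteq> 0"
    using that by (simp_all add: inverse_quat_def scaleR)
  show "x div y = x * inverse y"
    by (rule divide_quat_def)
  show "inverse (0::quat) = 0"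
    by (simp add: inverse_quat_def)
  show "norm (x * y) = norm x * norm y"
    unfolding norm_quat_def real_sqrt_mult [symmetric]
    by (rule arg_cong [where f = sqrt])
      (simp add: times_quat_def power2_eq_square algebra_simps)
qed

end

instantiation quat :: euclidean_space
begin

definition "Basis = {Quat 1 0 0 0, Quat 0 1 0 0, Quat 0 0 1 0, Quat 0 0 0 1}"

instance
proof
  fix u v x :: quat
  show "(Basis :: quat set) \<noteq> {}" "finite (Basis :: quat set)"
    by (simp_all add: Basis_quat_def)
  show "u \<bullet> v = (if u = v then 1 else 0)" if "u \<in> Basis" "v \<in> Basis"
    using that unfolding Basis_quat_def by (elim insertE emptyE) (simp_all add: inner_quat_def)
  show "(\<forall>u\<in>Basis. x \<bullet> u = 0) \<longleftrightarrow> x = 0"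
    by (cases x) (auto simp: Basis_quat_def inner_quat_def zero_quat_def)
qed

end


section \<open>Unilateral quaternionic polynomials\<close>

text \<open>
  A value of type \<open>quat poly\<close> is a finitely supported coefficient sequence; the polynomial
  $\sum_m q^m a_m$ is the one with \<open>coeff p m\<close> $= a_m$. The library's \<open>poly\<close>, \<open>(*)\<close> and
  \<open>pderiv\<close> are only available over commutative coefficient rings, hence the following
  counterparts, with powers of the variable to the left of the coefficients.
\<close>

definition qeval :: "quat poly \<Rightarrow> quat \<Rightarrow> quat" where
  "qeval p q = (\<Sum>m\<le>degree p. q ^ m * coeff p m)"

definition qpoly_mult :: "quat poly \<Rightarrow> quat poly \<Rightarrow> quat poly" (infixl "\<star>" 70) where
  "p \<star> r = (\<Sum>i\<le>degree p. \<Sum>j\<le>degree r. monom (coeff p i * coeff r j) (i + j))"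

definition qderiv :: "quat poly \<Rightarrow> quat poly" where
  "qderiv p = (\<Sum>m = 1..degree p. monom (of_nat m * coeff p m) (m - 1))"

definition qpoly_norm :: "quat poly \<Rightarrow> real" where
  "qpoly_norm p = (SUP q\<in>cball 0 1. norm (qeval p q))"

text \<open>The supremum is a maximum.\<close>

lemma qpoly_norm_attained:
  obtains q where "norm q \<le> 1" "norm (qeval p q) = qpoly_norm p"
    "\<And>r. norm r \<le> 1 \<Longrightarrow> norm (qeval p r) \<le> qpoly_norm p"
proof -
  have "continuous_on (cball 0 1) (\<lambda>q. norm (qeval p q))"
    unfolding qeval_def by (intro continuous_intros)
  then obtain q where q: "q \<in> cball 0 1"
    and le: "\<And>r. r \<in> cball 0 1 \<Longrightarrow> norm (qeval p r) \<le> norm (qeval p q)"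
    using continuous_attains_sup [of "cball 0 1" "\<lambda>q. norm (qeval p q)"] by auto
  have "qpoly_norm p = norm (qeval p q)"
    unfolding qpoly_norm_def using q le by (intro cSup_eq_maximum) auto
  then show ?thesis
    using that [of q] q le by (simp add: dist_norm)
qed


section \<open>The threshold\<close>

definition thr_A :: "real \<Rightarrow> real" where
  "thr_A k = - (((3 - k ^ 4) * k ^ 3 - 4 * k ^ 4) / (2 * (3 - k ^ 4)))"

definition thr_B :: "real \<Rightarrow> real" where
  "thr_B k = sqrt (((3 - k ^ 4) * k ^ 3 - 4 * k ^ 4)\<^sup>2 / (4 * (3 - k ^ 4)\<^sup>2)
                    + (4 * k ^ 3) ^ 3 / (27 * (3 - k ^ 4) ^ 3))"

text \<open>The library's \<open>root 3\<close> is the real cube root on all of \<open>\<real>\<close>; \<open>powr\<close> would be wrong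
  here, as \<open>thr_A k - thr_B k\<close> is negative in the
  relevant range \<open>1 \<le> k\<close>, \<open>k ^ 4 < 3\<close>.\<close>

definition x_star :: "real \<Rightarrow> real" where
  "x_star k = root 3 (thr_A k + thr_B k) + root 3 (thr_A k - thr_B k)"

end

theory Submission
  imports Defs
begin

text \<open>
  The two hypotheses on the roots are the vanishing of the coefficients of $q^3$ and $q^2$, so
  that $P(q) = q^4 + q c + d$ with $d = \alpha\beta\gamma\mu$, and $P'(q) = 4 q^3 + c$.
  Every quaternion is a cube, hence some $q$ in the unit sphere gives $q^3$ the direction of $c$
  and $\|P'\| \ge 4 + |c|$; trivially $\|P\| \le 1 + |c| + |d|$. The claim thus follows from
  $$(3 - k^4)\, |c| + 4\, |d| \le 4 k^4.$$
  For $k^4 \ge 3$ this is just $|d| \le k^4$.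

  For $k^4 < 3$, suppose that one root $\xi$ can be moved to either end of the products. Then
  the hypotheses say that the other three roots, taken in order, have elementary symmetric
  functions $e_1 = -\xi$ and $e_2 = \xi^2$, so that $c = -(\xi^3 + e_3)$. With $x = |\xi|$ this
  gives $|c| \le x^3 + k^3$ and $|d| \le x k^3$, and the inequality above follows from
  $$(3 - k^4)\, x^3 + 4 k^3 x + (3 - k^4) k^3 - 4 k^4 \le 0.$$
  The left-hand side increases with $x$, and Cardano's formula identifies its only real zero
  as \<open>x_star k\<close>. The outer roots $\alpha$, $\mu$ are at an end already, whereas the inner ones
  $\beta$, $\gamma$ can be moved there if they are real, since real quaternions are central.
\<close>

section \<open>Roots of quaternions\<close>

text \<open>
  Every quaternion lies in a plane spanned by $1$ and an imaginary unit $u$, and this plane is a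
  copy of the complex numbers, where roots exist.
\<close>

lemma quat_nth_root_exists:
  fixes c :: quat
  assumes "n > 0"
  obtains q where "q ^ n = c"
proof -
  define s where "s = sqrt ((qim1 c)\<^sup>2 + (qim2 c)\<^sup>2 + (qim3 c)\<^sup>2)"
  \<comment> \<open>A real \<open>c\<close> lies in all of these planes, so that any imaginary unit will do.\<close>
  define u where
    "u = (if s = 0 then Quat 0 1 0 0 else Quat 0 (qim1 c / s) (qim2 c / s) (qim3 c / s))"
  define h where "h z = Re z *\<^sub>R 1 + Im z *\<^sub>R u" for z
  have s2: "s\<^sup>2 = (qim1 c)\<^sup>2 + (qim2 c)\<^sup>2 + (qim3 c)\<^sup>2"
    by (simp add: s_def)
  have u2: "u * u = - 1"
  proof (cases "s = 0")
    case False
    then have "(qim1 c / s)\<^sup>2 + (qim2 c / s)\<^sup>2 + (qim3 c / s)\<^sup>2 = 1"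
      by (simp add: power_divide flip: add_divide_distrib s2)
    with False show ?thesis
      by (simp add: u_def times_quat_def one_quat_def uminus_quat_def power2_eq_square)
  qed (simp add: u_def times_quat_def one_quat_def uminus_quat_def)
  have h_mult: "h (z * w) = h z * h w" for z w
    by (simp add: h_def algebra_simps u2)
  have h_power: "h z ^ m = h (z ^ m)" for z m
    by (induction m) (simp_all add: h_mult, simp add: h_def)
  have "h (Complex (qre c) s) = c"
  proof (cases "s = 0")
    case True
    then have "qim1 c = 0" "qim2 c = 0" "qim3 c = 0"
      using s2 by (simp_all add: add_nonneg_eq_0_iff)
    with True show ?thesis
      by (simp add: h_def scaleR_quat_def one_quat_def plus_quat_def quat_eq_iff zero_quat_def)
  qed (simp add: h_def u_def scaleR_quat_def one_quat_def plus_quat_def quat_eq_iff)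
  moreover obtain w where "w ^ n = Complex (qre c) s"
    using assms by (metis exists_complex_root less_irrefl)
  ultimately show thesis
    using that [of "h w"] by (simp add: h_power)
qed

section \<open>Norms of a depressed quartic and of its derivative\<close>

lemma qpoly_norm_upper:
  assumes "\<And>q. norm q \<le> 1 \<Longrightarrow> norm (qeval p q) \<le> B"
  shows "qpoly_norm p \<le> B"
  using assms qpoly_norm_attained by metis

lemma norm_qeval_le_qpoly_norm:
  assumes "norm q \<le> 1"
  shows "norm (qeval p q) \<le> qpoly_norm p"
  using assms qpoly_norm_attained by metis

lemma qpoly_norm_depressed_quartic_le:
  "qpoly_norm [:d, c, 0, 0, 1:] \<le> 1 + norm c + norm d"
proof (rule qpoly_norm_upper)
  fix q :: quat
  assume q: "norm q \<le> 1"
  have "qeval [:d, c, 0, 0, 1:] q = d + q * c + q ^ 4"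
    by (simp add: qeval_def numeral_eq_Suc)
  also have "norm \<dots> \<le> norm d + norm q * norm c + norm q ^ 4"
    by (rule norm_triangle_le) (auto intro!: norm_triangle_le simp: norm_mult norm_power)
  also have "\<dots> \<le> 1 + norm c + norm d"
    using q mult_left_le_one_le [of "norm c" "norm q"] power_le_one [of "norm q" 4] by simp
  finally show "norm (qeval [:d, c, 0, 0, 1:] q) \<le> 1 + norm c + norm d" .
qed

lemma qderiv_depressed_quartic: "qderiv [:d, c, 0, 0, 1:] = [:c, 0, 0, 4:]"
  by (simp add: qderiv_def numeral_eq_Suc monom_Suc monom_0)

text \<open>
  A cube root of the direction of $c$ aligns the two terms of $4 q^3 + c$.
\<close>

lemma qpoly_norm_qderiv_depressed_quartic_ge:
  "4 + norm c \<le> qpoly_norm (qderiv [:d, c, 0, 0, 1:])"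
proof -
  \<comment> \<open>For \<open>c = 0\<close> every unit quaternion is a direction of \<open>c\<close>.\<close>
  define e where "e = (if c = 0 then 1 else sgn c)"
  have e: "norm e = 1" "c = norm c *\<^sub>R e"
    by (auto simp: e_def norm_sgn sgn_div_norm)
  obtain q where q: "q ^ 3 = e"
    by (rule quat_nth_root_exists [of 3 e]) auto
  have "norm q ^ 3 = 1"
    using e(1) q by (metis norm_power)
  then have "norm q = 1"
    using power_eq_iff_eq_base [of 3 "norm q" 1] by simp
  moreover have "qeval [:c, 0, 0, 4:] q = (4 + norm c) *\<^sub>R e"
  proof -
    have "qeval [:c, 0, 0, 4:] q = c + q ^ 3 * 4"
      by (simp add: qeval_def numeral_eq_Suc)
    also have "q ^ 3 * 4 = e * of_real 4"
      by (simp add: q)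
    also have "\<dots> = (4::real) *\<^sub>R e"
      by (simp add: of_real_def del: of_real_numeral)
    finally show ?thesis
      using e(2) by (simp add: scaleR_add_left)
  qed
  ultimately show ?thesis
    using norm_qeval_le_qpoly_norm [of q "[:c, 0, 0, 4:]"] e(1)
    by (simp add: qderiv_depressed_quartic)
qed

lemma quartic_eq_coefficients:
  fixes \<alpha> \<beta> \<gamma> \<mu> :: quat
  shows "[:- \<alpha>, 1:] \<star> [:- \<beta>, 1:] \<star> [:- \<gamma>, 1:] \<star> [:- \<mu>, 1:] =
    [: \<alpha> * \<beta> * \<gamma> * \<mu>, - (\<alpha> * \<beta> * \<gamma> + \<alpha> * \<beta> * \<mu> + \<alpha> * \<gamma> * \<mu> + \<beta> * \<gamma> * \<mu>),
       \<alpha> * \<beta> + \<alpha> * \<gamma> + \<alpha> * \<mu> + \<beta> * \<gamma> + \<beta> * \<mu> + \<gamma> * \<mu>, - (\<alpha> + \<beta> + \<gamma> + \<mu>), 1:]"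
  by (simp add: qpoly_mult_def numeral_eq_Suc monom_Suc monom_0 algebra_simps)

text \<open>
  What remains of the claim once the norms are estimated: clearing the denominator in
  $4 + |c| \ge \frac{4}{1 + k^4} (1 + |c| + |d|)$ leaves the hypothesis.
\<close>

lemma depressed_quartic_derivative_bound:
  fixes k :: real
  assumes "(3 - k ^ 4) * norm c + 4 * norm d \<le> 4 * k ^ 4"
  shows "4 / (1 + k ^ 4) * qpoly_norm [:d, c, 0, 0, 1:] \<le> qpoly_norm (qderiv [:d, c, 0, 0, 1:])"
proof -
  have pos: "1 + k ^ 4 > 0"
    by (simp add: add_pos_nonneg)
  have "4 / (1 + k ^ 4) * qpoly_norm [:d, c, 0, 0, 1:] \<le> 4 / (1 + k ^ 4) * (1 + norm c + norm d)"
    using qpoly_norm_depressed_quartic_le pos by (intro mult_left_mono) auto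
  also have "\<dots> \<le> 4 + norm c"
    using assms pos by (simp add: field_simps)
  also note qpoly_norm_qderiv_depressed_quartic_ge
  finally show ?thesis .
qed

section \<open>The threshold as a root of a cubic\<close>

text \<open>
  The two cube roots $u$, $v$ have product $-p/3$, so that $(u + v)^3 = u^3 + v^3 + 3uv(u + v)$
  becomes the cubic equation.
\<close>

lemma cardano:
  fixes p r :: real
  assumes "p \<ge> 0"
  defines "b \<equiv> sqrt (r\<^sup>2 / 4 + p ^ 3 / 27)"
  defines "x \<equiv> root 3 (- r / 2 + b) + root 3 (- r / 2 - b)"
  shows "x ^ 3 + p * x + r = 0"
proof -
  define u v where "u = root 3 (- r / 2 + b)" and "v = root 3 (- r / 2 - b)"
  have cubes: "u ^ 3 = - r / 2 + b" "v ^ 3 = - r / 2 - b"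
    by (simp_all add: u_def v_def odd_real_root_pow)
  have "b\<^sup>2 = r\<^sup>2 / 4 + p ^ 3 / 27"
    using assms(1) by (simp add: b_def)
  then have "(u * v) ^ 3 = (- p / 3) ^ 3"
    by (simp add: power_mult_distrib cubes power_divide) (simp add: algebra_simps power2_eq_square)
  then have uv: "u * v = - p / 3"
    using odd_real_root_power_cancel [of 3] by (metis odd_numeral)
  have "(u + v) ^ 3 = u ^ 3 + v ^ 3 + 3 * (u * v) * (u + v)"
    by algebra
  moreover have "x = u + v"
    by (simp add: x_def u_def v_def)
  ultimately show ?thesis
    by (simp add: cubes uv)
qed

lemma x_star_cubic:
  assumes "k \<ge> 0" and "k ^ 4 < 3"
  shows "(3 - k ^ 4) * x_star k ^ 3 + 4 * k ^ 3 * x_star k + (3 - k ^ 4) * k ^ 3 - 4 * k ^ 4 = 0"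
proof -
  define D where "D = 3 - k ^ 4"
  have D: "D > 0"
    using assms by (simp add: D_def)
  define p r where "p = 4 * k ^ 3 / D" and "r = (D * k ^ 3 - 4 * k ^ 4) / D"
  have "thr_A k = - r / 2"
    by (simp add: thr_A_def r_def flip: D_def)
  moreover have "thr_B k = sqrt (r\<^sup>2 / 4 + p ^ 3 / 27)"
    by (simp add: thr_B_def r_def p_def power_divide flip: D_def)
  ultimately have "x_star k ^ 3 + p * x_star k + r = 0"
    using cardano [of p r] assms D by (simp add: x_star_def p_def)
  then have "D * (x_star k ^ 3 + p * x_star k + r) = 0"
    by simp
  also have "D * (x_star k ^ 3 + p * x_star k + r) =
      D * x_star k ^ 3 + (D * p) * x_star k + D * r"
    by (simp add: algebra_simps)
  finally show ?thesis
    using D by (simp add: p_def r_def flip: D_def)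
qed

lemma cubic_nonpos_below_x_star:
  assumes "k \<ge> 0" and "k ^ 4 < 3" and "0 \<le> x" and "x \<le> x_star k"
  shows "(3 - k ^ 4) * (x ^ 3 + k ^ 3) + 4 * (x * k ^ 3) \<le> 4 * k ^ 4"
proof -
  have "(3 - k ^ 4) * x ^ 3 \<le> (3 - k ^ 4) * x_star k ^ 3"
    using assms by (intro mult_left_mono power_mono) auto
  moreover have "4 * k ^ 3 * x \<le> 4 * k ^ 3 * x_star k"
    using assms by (intro mult_left_mono) auto
  ultimately show ?thesis
    using x_star_cubic [OF assms(1,2)] by (simp add: algebra_simps)
qed

text \<open>
  Here \<open>\<xi>\<close> is the root of small norm and \<open>t\<close> the product of the other three.
\<close>

lemma coefficient_bound_below_x_star:
  fixes c d \<xi> t :: quat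
  assumes k: "k \<ge> 0" "k ^ 4 < 3" and \<xi>: "norm \<xi> \<le> x_star k"
    and c: "c = - (\<xi> ^ 3 + t)" and d: "norm d = norm \<xi> * norm t" and t: "norm t \<le> k ^ 3"
  shows "(3 - k ^ 4) * norm c + 4 * norm d \<le> 4 * k ^ 4"
proof -
  have "norm c = norm (\<xi> ^ 3 + t)"
    by (simp only: c norm_minus_cancel)
  also have "\<dots> \<le> norm \<xi> ^ 3 + k ^ 3"
    using norm_triangle_ineq [of "\<xi> ^ 3" t] t by (simp add: norm_power)
  finally have "(3 - k ^ 4) * norm c \<le> (3 - k ^ 4) * (norm \<xi> ^ 3 + k ^ 3)"
    using k by (intro mult_left_mono) auto
  moreover have "norm d \<le> norm \<xi> * k ^ 3"
    using t d by (simp add: mult_left_mono)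
  ultimately show ?thesis
    using cubic_nonpos_below_x_star [OF k _ \<xi>] by simp
qed

section \<open>Isolating one root in the coefficient \<open>c\<close>\<close>

text \<open>
  The hypotheses of the next two lemmas give $e_1 = -\xi$ and $e_2 = \xi^2$ for the other three
  roots, whichever side \<open>\<xi>\<close> is on.
\<close>

lemma linear_coefficient_isolate_first:
  fixes \<xi> a b c :: "'a :: ring_1"
  assumes "\<xi> + a + b + c = 0"
    and "\<xi> * a + \<xi> * b + \<xi> * c + a * b + a * c + b * c = 0"
  shows "\<xi> * a * b + \<xi> * a * c + \<xi> * b * c + a * b * c = \<xi> ^ 3 + a * b * c"
proof -
  have "a + b + c = - \<xi>"
    using assms(1) minus_unique [of \<xi> "a + b + c"] by (simp add: add.assoc)
  moreover have "\<xi> * (a + b + c) + (a * b + a * c + b * c) = 0"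
    using assms(2) by (simp add: algebra_simps)
  ultimately have "a * b + a * c + b * c = \<xi> * \<xi>"
    by simp
  then have "\<xi> * (a * b + a * c + b * c) = \<xi> ^ 3"
    by (simp add: power3_eq_cube mult.assoc)
  then show ?thesis
    by (simp add: algebra_simps)
qed

lemma linear_coefficient_isolate_last:
  fixes \<xi> a b c :: "'a :: ring_1"
  assumes "a + b + c + \<xi> = 0"
    and "a * b + a * c + a * \<xi> + b * c + b * \<xi> + c * \<xi> = 0"
  shows "a * b * c + a * b * \<xi> + a * c * \<xi> + b * c * \<xi> = \<xi> ^ 3 + a * b * c"
proof -
  have "a + b + c = - \<xi>"
    using assms(1) by (simp add: eq_neg_iff_add_eq_0)
  moreover have "(a + b + c) * \<xi> + (a * b + a * c + b * c) = 0"
    using assms(2) by (simp add: algebra_simps)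
  ultimately have "a * b + a * c + b * c = \<xi> * \<xi>"
    by simp
  then have "(a * b + a * c + b * c) * \<xi> = \<xi> ^ 3"
    by (simp add: power3_eq_cube)
  then show ?thesis
    by (simp add: algebra_simps)
qed

lemma Reals_central:
  fixes a b :: "'a :: real_algebra_1"
  assumes "a \<in> \<real>"
  shows "a * b = b * a"
  using assms by (auto simp: Reals_def of_real_def)

lemma norm_mult3_le_power3:
  fixes a b c :: "'a :: real_normed_div_algebra"
  assumes "norm a \<le> k" "norm b \<le> k" "norm c \<le> k"
  shows "norm (a * b * c) \<le> k ^ 3"
proof -
  have "k \<ge> 0"
    using assms(1) norm_ge_zero order_trans by blast
  then show ?thesis
    using assms by (auto simp: norm_mult power3_eq_cube intro!: mult_mono)
qed

section \<open>The derivative estimate\<close>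

theorem theorem3p3:
  fixes k :: real and \<alpha> \<beta> \<gamma> \<mu> :: quat and P :: "quat poly"
  assumes "k \<ge> 1"
    and "norm \<alpha> \<le> k" and "norm \<beta> \<le> k" and "norm \<gamma> \<le> k" and "norm \<mu> \<le> k"
    and "\<alpha> + \<beta> + \<gamma> + \<mu> = 0"
    and "\<alpha> * \<beta> + \<alpha> * \<gamma> + \<alpha> * \<mu> + \<beta> * \<gamma> + \<beta> * \<mu> + \<gamma> * \<mu> = 0"
    and "P = [:- \<alpha>, 1:] \<star> [:- \<beta>, 1:] \<star> [:- \<gamma>, 1:] \<star> [:- \<mu>, 1:]"
  shows "(k < 3 powr (1/4) \<longrightarrow>
            norm \<alpha> \<le> x_star k \<or> (\<beta> \<in> \<real> \<and> norm \<beta> \<le> x_star k)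
              \<or> (\<gamma> \<in> \<real> \<and> norm \<gamma> \<le> x_star k) \<or> norm \<mu> \<le> x_star k \<longrightarrow>
            qpoly_norm (qderiv P) \<ge> 4 / (1 + k ^ 4) * qpoly_norm P)
       \<and> (k \<ge> 3 powr (1/4) \<longrightarrow>
            qpoly_norm (qderiv P) \<ge> 4 / (1 + k ^ 4) * qpoly_norm P)"
proof -
  define c where "c = - (\<alpha> * \<beta> * \<gamma> + \<alpha> * \<beta> * \<mu> + \<alpha> * \<gamma> * \<mu> + \<beta> * \<gamma> * \<mu>)"
  define d where "d = \<alpha> * \<beta> * \<gamma> * \<mu>"
  have k0: "k \<ge> 0"
    using assms(1) by simp
  have P: "P = [:d, c, 0, 0, 1:]"
    unfolding assms(8) quartic_eq_coefficients assms(6,7) c_def d_def by simp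
  have threshold: "(3 powr (1/4)) ^ 4 = (3::real)"
    by (simp add: powr_power)
  note e1 = assms(6) and e2 = assms(7)
  \<comment> \<open>Stated so that for large \<open>k\<close> the premise holds vacuously, which covers both parts.\<close>
  have bound: "(3 - k ^ 4) * norm c + 4 * norm d \<le> 4 * k ^ 4"
    if small: "k < 3 powr (1/4) \<Longrightarrow> norm \<alpha> \<le> x_star k \<or> (\<beta> \<in> \<real> \<and> norm \<beta> \<le> x_star k)
      \<or> (\<gamma> \<in> \<real> \<and> norm \<gamma> \<le> x_star k) \<or> norm \<mu> \<le> x_star k"
  proof (cases "k < 3 powr (1/4)")
    case False
    then have "k ^ 4 \<ge> 3"
      using power_mono [of "3 powr (1/4)" k 4] threshold by simp
    then have "(3 - k ^ 4) * norm c \<le> 0"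
      by (simp add: mult_nonpos_nonneg)
    moreover have "norm d \<le> k ^ 3 * k"
      unfolding d_def norm_mult [of _ \<mu>]
      using assms(2-5) k0 by (intro mult_mono norm_mult3_le_power3) auto
    ultimately show ?thesis
      by (simp add: power3_eq_cube power4_eq_xxxx)
  next
    case True
    then have k4: "k ^ 4 < 3"
      using power_strict_mono [of k "3 powr (1/4)" 4] threshold k0 by simp
    note est = coefficient_bound_below_x_star [OF k0 k4]
    from small [OF True] consider
      "norm \<alpha> \<le> x_star k" | "\<beta> \<in> \<real>" "norm \<beta> \<le> x_star k"
      | "\<gamma> \<in> \<real>" "norm \<gamma> \<le> x_star k" | "norm \<mu> \<le> x_star k"
      by blast
    then show ?thesis
    proof cases
      case 1
      show ?thesis
      proof (rule est [OF 1])
        show "c = - (\<alpha> ^ 3 + \<beta> * \<gamma> * \<mu>)"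
          unfolding c_def linear_coefficient_isolate_first [OF e1 e2] ..
        show "norm (\<beta> * \<gamma> * \<mu>) \<le> k ^ 3"
          by (intro norm_mult3_le_power3 assms)
      qed (simp add: d_def norm_mult)
    next
      case 2
      note comm = Reals_central [OF 2(1), of \<alpha>]
      show ?thesis
      proof (rule est [OF 2(2)])
        have "\<beta> * \<alpha> * \<gamma> + \<beta> * \<alpha> * \<mu> + \<beta> * \<gamma> * \<mu> + \<alpha> * \<gamma> * \<mu> = \<beta> ^ 3 + \<alpha> * \<gamma> * \<mu>"
          by (rule linear_coefficient_isolate_first) (use e1 e2 in \<open>simp_all add: comm ac_simps\<close>)
        then show "c = - (\<beta> ^ 3 + \<alpha> * \<gamma> * \<mu>)"
          unfolding c_def by (subst neg_equal_iff_equal) (simp add: comm add_ac)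
        show "norm (\<alpha> * \<gamma> * \<mu>) \<le> k ^ 3"
          by (intro norm_mult3_le_power3 assms)
      qed (simp add: d_def norm_mult)
    next
      case 3
      note comm = Reals_central [OF 3(1), of \<mu>]
      show ?thesis
      proof (rule est [OF 3(2)])
        have "\<alpha> * \<beta> * \<mu> + \<alpha> * \<beta> * \<gamma> + \<alpha> * \<mu> * \<gamma> + \<beta> * \<mu> * \<gamma> = \<gamma> ^ 3 + \<alpha> * \<beta> * \<mu>"
          by (rule linear_coefficient_isolate_last)
             (use e1 e2 in \<open>simp_all add: comm add_ac\<close>)
        then show "c = - (\<gamma> ^ 3 + \<alpha> * \<beta> * \<mu>)"
          unfolding c_def by (subst neg_equal_iff_equal) (simp add: mult.assoc comm add_ac)
        show "norm (\<alpha> * \<beta> * \<mu>) \<le> k ^ 3"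
          by (intro norm_mult3_le_power3 assms)
      qed (simp add: d_def norm_mult)
    next
      case 4
      show ?thesis
      proof (rule est [OF 4])
        show "c = - (\<mu> ^ 3 + \<alpha> * \<beta> * \<gamma>)"
          unfolding c_def linear_coefficient_isolate_last [OF e1 e2] ..
        show "norm (\<alpha> * \<beta> * \<gamma>) \<le> k ^ 3"
          by (intro norm_mult3_le_power3 assms)
      qed (simp add: d_def norm_mult)
    qed
  qed
  show ?thesis
    unfolding P
  proof (intro conjI impI)
    assume "k \<ge> 3 powr (1/4)"
    then show "4 / (1 + k ^ 4) * qpoly_norm [:d, c, 0, 0, 1:]
        \<le> qpoly_norm (qderiv [:d, c, 0, 0, 1:])"
      by (intro depressed_quartic_derivative_bound bound) simp
  qed (intro depressed_quartic_derivative_bound bound)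
qed

end
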